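(* Let $\Gamma$ be a group equipped with a linear representation $\rho:\Gamma\to GL(\mathbb{F}^d)$ over a field $\mathbb{F}$, and let $(G=(V,E),\psi)$ be a finite $\Gamma$-gain graph. Then $$f_\rho(E)=\dim_{\mathbb{F}}\operatorname{span}\{A_{e,\psi}\mid e\in E\}.$$
   Context: A $\Gamma$-gain graph $(G,\psi)$: $G=(V,E)$ a finite directed graph (loops, parallel edges allowed), $\psi:E\to\Gamma$, reversing an edge inverts its gain. The gain of a walk is the product of gains of its edges in order, using $\psi(e)^{-1}$ for edges traversed backwards. For $X\subseteq E$, $v\in V$, $\langle X\rangle_{\psi,v}$ is the subgroup of gains of closed walks at $v$ using only edges in $X$. For $F\subseteq E$, $V(F)$ is the set of endvertices of $F$, $C(F)$ the partition of $F$ into edge sets of connected components of $(V(F),F)$, $c(F)=|C(F)|$. Define $d_\rho(X)=\dim_{\mathbb{F}}\operatorname{span}\{\operatorname{image}(I_d-\rho(\gamma))\mid\gamma\in X\}$ for $X\subseteq\Gamma$ ($d_\rho(\emptyset)=0$), and for connected $X\subseteq E$ let $d_\rho\langle X\rangle=d_\rho(\langle X\rangle_{\psi,v})$ for any $v\in V(X)$ (independent of $v$). Let $f_\rho(F)=d|V(F)|-d\,c(F)+\sum_{X\in C(F)}d_\rho\langle X\rangle$ for $F\subseteq E$. For $x\in(\mathbb{F}^d)^V$, $x(W)=0$ means $x(w)=0$ for all $w\in W$. For a non-loop edge $e$ from $i$ to $j$, $A_{e,\psi}=\{x\in(\mathbb{F}^d)^V : x(i)+\rho(\psi(e))x(j)=0,\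 x(V\setminus\{i,j\})=0\}$; for a loop $e$ at $i$, $A_{e,\psi}=\{x\in(\mathbb{F}^d)^V:\exists\alpha\in\mathbb{F}^d,\ x(i)=(I_d-\rho(\psi(e)))\alpha,\ x(V\setminus\{i\})=0\}$. *)

theory Defs
  imports
    "HOL-Library.Function_Algebras"
    "HOL-Analysis.Cartesian_Space"
    "HOL-Algebra.Group"
    "Graph_Theory.Digraph_Component"
begin

section \<open>Gain graphs\<close>

text \<open>
  The underlying directed graph is a \<open>pre_digraph\<close>, so loops and parallel arcs are allowed, and the
  gains are a function on arcs.  A walk may traverse an arc backwards; it is therefore an
  \<open>awalk\<close> in the digraph below, in which each arc \<open>e\<close> has a forward copy \<open>(e, True)\<close> and a
  backward copy \<open>(e, False)\<close>.
\<close>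

definition two_way :: "('v, 'e) pre_digraph \<Rightarrow> 'e set \<Rightarrow> ('v, 'e \<times> bool) pre_digraph" where
  "two_way G X = \<lparr> verts = verts G, arcs = X \<times> UNIV,
     tail = (\<lambda>(e, fwd). if fwd then tail G e else head G e),
     head = (\<lambda>(e, fwd). if fwd then head G e else tail G e) \<rparr>"

definition arc_gain :: "('g, 'm) monoid_scheme \<Rightarrow> ('e \<Rightarrow> 'g) \<Rightarrow> 'e \<times> bool \<Rightarrow> 'g" where
  "arc_gain \<Gamma> \<psi> = (\<lambda>(e, fwd). if fwd then \<psi> e else inv\<^bsub>\<Gamma>\<^esub> \<psi> e)"

definition walk_gain :: "('g, 'm) monoid_scheme \<Rightarrow> ('e \<Rightarrow> 'g) \<Rightarrow> ('e \<times> bool) list \<Rightarrow> 'g" where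
  "walk_gain \<Gamma> \<psi> p = foldr (\<lambda>a g. arc_gain \<Gamma> \<psi> a \<otimes>\<^bsub>\<Gamma>\<^esub> g) p \<one>\<^bsub>\<Gamma>\<^esub>"

definition gain_subgroup ::
    "('g, 'm) monoid_scheme \<Rightarrow> ('v, 'e) pre_digraph \<Rightarrow> ('e \<Rightarrow> 'g) \<Rightarrow> 'e set \<Rightarrow> 'v \<Rightarrow> 'g set" where
  "gain_subgroup \<Gamma> G \<psi> X v =
     {walk_gain \<Gamma> \<psi> p | p. pre_digraph.awalk (two_way G X) v p v}"

definition endverts :: "('v, 'e) pre_digraph \<Rightarrow> 'e set \<Rightarrow> 'v set" where
  "endverts G F = tail G ` F \<union> head G ` F"

definition edge_subgraph :: "('v, 'e) pre_digraph \<Rightarrow> 'e set \<Rightarrow> ('v, 'e) pre_digraph" where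
  "edge_subgraph G F = \<lparr> verts = endverts G F, arcs = F, tail = tail G, head = head G \<rparr>"

text \<open>
  \<open>Digraph_Component.connected\<close> is connectedness of the underlying undirected graph (and requires
  a vertex), so its maximal subgraphs are the connected components.
\<close>

definition edge_components :: "('v, 'e) pre_digraph \<Rightarrow> 'e set \<Rightarrow> 'e set set" where
  "edge_components G F =
     arcs ` {H. pre_digraph.max_subgraph (edge_subgraph G F) Digraph_Component.connected H}"

section \<open>Linear representations and the rank function\<close>

definition GL :: "('f::field ^ 'd ^ 'd) monoid" where
  "GL = \<lparr> carrier = {A. invertible A}, monoid.mult = (**), one = mat 1 \<rparr>"

definition rep_dim :: "('g \<Rightarrow> 'f::field ^ 'd ^ 'd) \<Rightarrow> 'g set \<Rightarrow> nat" where
  "rep_dim \<rho> X = vec.dim (vec.span (\<Union>\<gamma>\<in>X. range (\<lambda>a. (mat 1 - \<rho> \<gamma>) *v a)))"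

text \<open>
  For connected \<open>X\<close> the value does not depend on the base vertex, because the groups at two
  vertices of \<open>X\<close> are conjugate.
\<close>

definition gain_rep_dim ::
    "('g, 'm) monoid_scheme \<Rightarrow> ('g \<Rightarrow> 'f::field ^ 'd ^ 'd) \<Rightarrow> ('v, 'e) pre_digraph \<Rightarrow> ('e \<Rightarrow> 'g)
      \<Rightarrow> 'e set \<Rightarrow> nat" where
  "gain_rep_dim \<Gamma> \<rho> G \<psi> X = rep_dim \<rho> (gain_subgroup \<Gamma> G \<psi> X (SOME v. v \<in> endverts G X))"

definition gain_rank ::
    "('g, 'm) monoid_scheme \<Rightarrow> ('g \<Rightarrow> 'f::field ^ 'd ^ 'd) \<Rightarrow> ('v, 'e) pre_digraph \<Rightarrow> ('e \<Rightarrow> 'g)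
      \<Rightarrow> 'e set \<Rightarrow> int" where
  "gain_rank \<Gamma> \<rho> G \<psi> F =
     int CARD('d) * int (card (endverts G F)) - int CARD('d) * int (card (edge_components G F))
     + (\<Sum>X\<in>edge_components G F. int (gain_rep_dim \<Gamma> \<rho> G \<psi> X))"

section \<open>The subspaces attached to the edges\<close>

definition vfun_scale :: "'f::field \<Rightarrow> ('v \<Rightarrow> 'f ^ 'd) \<Rightarrow> 'v \<Rightarrow> 'f ^ 'd" where
  "vfun_scale c x = (\<lambda>v. c *s x v)"

global_interpretation vfun: vector_space vfun_scale
  by unfold_locales
    (simp_all add: vfun_scale_def fun_eq_iff vec.scale_right_distrib vec.scale_left_distrib)

text \<open>
  For a set \<open>V\<close> of vertices, $(F^d)^V$ is represented by the functions that vanish outside \<open>V\<close>.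
\<close>

definition vfuns :: "'v set \<Rightarrow> ('v \<Rightarrow> 'f::field ^ 'd) set" where
  "vfuns V = {x. \<forall>w. w \<notin> V \<longrightarrow> x w = 0}"

definition edge_space ::
    "('g \<Rightarrow> 'f::field ^ 'd ^ 'd) \<Rightarrow> ('v, 'e) pre_digraph \<Rightarrow> ('e \<Rightarrow> 'g) \<Rightarrow> 'e
      \<Rightarrow> ('v \<Rightarrow> 'f ^ 'd) set" where
  "edge_space \<rho> G \<psi> e =
     (let i = tail G e; j = head G e; V = verts G in
      if i \<noteq> j
      then {x \<in> vfuns V. x i + \<rho> (\<psi> e) *v x j = 0 \<and> (\<forall>w \<in> V - {i, j}. x w = 0)}
      else {x \<in> vfuns V. (\<exists>a. x i = (mat 1 - \<rho> (\<psi> e)) *v a) \<and> (\<forall>w \<in> V - {i}. x w = 0)})"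

end

theory Submission
  imports Defs
begin

text \<open>
  Choose a root in each connected component and, for each vertex \<open>w\<close>, a walk to \<open>w\<close> from the root of
  its component, with gain \<open>g\<^sub>w\<close>.  The linear automorphism of $(F^d)^V$ that sends \<open>x\<close> to
  \<open>\<rho>(g\<^sub>w) x(w)\<close> at a non-root \<open>w\<close>, and to the sum of all \<open>\<rho>(g\<^sub>u) x(u)\<close> over the component at a root,
  maps the span of the edge spaces onto a product of subspaces of $F^d$, one for each vertex: the
  whole of $F^d$ at a non-root, and the span of the images of \<open>I - \<rho>(\<gamma>)\<close> for the gains \<open>\<gamma>\<close> of closed
  walks at a root.  Adding up the dimensions gives the formula.
\<close>

section \<open>Vertex functions\<close>

definition single :: "'v \<Rightarrow> 'f::field ^ 'd \<Rightarrow> 'v \<Rightarrow> 'f ^ 'd" where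
  "single v a = (\<lambda>w. if w = v then a else 0)"

lemma single_apply: "single v a w = (if w = v then a else 0)"
  by (simp add: single_def)

lemma single_zero [simp]: "single v 0 = 0"
  by (auto simp: single_def fun_eq_iff)

lemma single_add: "single v (a + b) = single v a + single v b"
  by (auto simp: single_def fun_eq_iff)

lemma single_diff: "single v (a - b) = single v a - single v b"
  by (auto simp: single_def fun_eq_iff)

lemma single_scale: "single v (c *s a) = vfun_scale c (single v a)"
  by (auto simp: single_def vfun_scale_def fun_eq_iff)

lemma single_sum: "single v (sum f A) = (\<Sum>x\<in>A. single v (f x))"
  by (induction A rule: infinite_finite_induct) (auto simp: single_add)

lemma sum_fun_apply: "(\<Sum>x\<in>A. f x) w = (\<Sum>x\<in>A. f x w)"
  for f :: "'a \<Rightarrow> 'v \<Rightarrow> 'b::comm_monoid_add"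
  by (induction A rule: infinite_finite_induct) auto

lemma vfuns_eq_sum_single:
  assumes "finite V" "x \<in> vfuns V"
  shows "x = (\<Sum>w\<in>V. single w (x w))"
proof
  fix u
  show "x u = (\<Sum>w\<in>V. single w (x w)) u"
    using assms by (auto simp: sum_fun_apply single_apply vfuns_def)
qed

lemma subspace_vfuns: "vfun.subspace (vfuns V)"
  by (auto simp: vfun.subspace_def vfuns_def vfun_scale_def)

lemma single_in_span:
  assumes "a \<in> vec.span B"
  shows "single v a \<in> vfun.span (single v ` B)"
  using assms
proof (induction rule: vec.span_induct_alt)
  case base
  show ?case by (simp only: single_zero vfun.span_zero)
next
  case (step c x y)
  then show ?case
    unfolding single_add single_scale
    by (intro vfun.span_add vfun.span_scale) (auto intro: vfun.span_base)
qed

text \<open>Copies of bases of the factors, each placed at its own vertex, together form a basis of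
  the product.\<close>

lemma dim_pointwise_subspaces:
  fixes S :: "'v \<Rightarrow> ('f::field ^ 'd) set"
  assumes fin: "finite V" and sub: "\<And>w. w \<in> V \<Longrightarrow> vec.subspace (S w)"
  shows "vfun.dim {x \<in> vfuns V. \<forall>w\<in>V. x w \<in> S w} = (\<Sum>w\<in>V. vec.dim (S w))"
    (is "vfun.dim ?P = _")
proof -
  have "\<exists>B. B \<subseteq> S w \<and> vec.independent B \<and> S w \<subseteq> vec.span B \<and> card B = vec.dim (S w)" for w
    using vec.basis_exists[of "S w"] by metis
  then obtain B where B: "\<And>w. B w \<subseteq> S w" "\<And>w. vec.independent (B w)"
      "\<And>w. S w \<subseteq> vec.span (B w)" "\<And>w. card (B w) = vec.dim (S w)"
    by metis
  have finB: "finite (B w)" for w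
    using B(2) vec.finiteI_independent by blast
  \<comment> \<open>The zero function is the only one that two coordinate copies at different
    vertices could share, so this makes the copies disjoint.\<close>
  have nz: "0 \<notin> B w" for w
    using B(2) vec.dependent_zero by blast
  let ?C = "\<Union>w\<in>V. single w ` B w"
  have inj: "inj (single w :: 'f ^ 'd \<Rightarrow> _)" for w :: 'v
    by (rule injI) (metis single_apply)
  have disj: "single v ` B v \<inter> single w ` B w = {}" if "v \<noteq> w" for v w
    using nz that by (auto simp: single_def fun_eq_iff) metis
  \<comment> \<open>The type \<open>'z\<close> stays open because the rule serves twice: with vector
    values for independence, and with the constant 1 for the cardinality of the basis.\<close>
  have sumC: "sum h ?C = (\<Sum>w\<in>V. \<Sum>b\<in>B w. h (single w b))"
    for h :: "('v \<Rightarrow> 'f ^ 'd) \<Rightarrow> 'z::comm_monoid_add"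
    by (subst sum.UNION_disjoint)
      (use fin finB disj inj in \<open>auto simp: sum.reindex inj_on_subset[OF inj] intro!: sum.cong\<close>)
  have ind: "vfun.independent ?C"
  proof (rule vfun.independent_if_scalars_zero)
    show "finite ?C" using fin finB by auto
    fix f x
    assume z: "(\<Sum>x\<in>?C. vfun_scale (f x) x) = 0" and x: "x \<in> ?C"
    then obtain w b where w: "w \<in> V" "b \<in> B w" "x = single w b" by auto
    \<comment> \<open>Evaluation at \<open>w\<close> kills all blocks except the one at
      \<open>w\<close>, leaving a linear relation inside the independent set
      \<open>B w\<close>.\<close>
    have "0 = (\<Sum>v\<in>V. \<Sum>b\<in>B v. vfun_scale (f (single v b)) (single v b)) w"
      using z by (simp add: sumC)
    also have "\<dots> = (\<Sum>v\<in>V. if v = w then \<Sum>b\<in>B w. f (single w b) *s b else 0)"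
      by (auto simp: sum_fun_apply vfun_scale_def single_apply intro!: sum.cong)
    also have "\<dots> = (\<Sum>b\<in>B w. f (single w b) *s b)"
      using fin w by simp
    finally show "f x = 0"
      using vec.independentD[OF B(2) finB subset_refl _ w(2), where u = "\<lambda>b. f (single w b)"] w(3)
      by simp
  qed
  have subP: "vfun.subspace ?P"
    using sub by (auto simp: vfun.subspace_def vfuns_def vfun_scale_def vec.subspace_def)
  have CP: "?C \<subseteq> ?P"
    using B(1) sub by (fastforce simp: vfuns_def single_def vec.subspace_0)
  have PC: "?P \<subseteq> vfun.span ?C"
  proof
    fix x assume x: "x \<in> ?P"
    have "single w (x w) \<in> vfun.span ?C" if "w \<in> V" for w
    proof -
      have "x w \<in> vec.span (B w)" using x B(3) that by blast
      then have "single w (x w) \<in> vfun.span (single w ` B w)" by (rule single_in_span)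
      then show ?thesis using vfun.span_mono[of "single w ` B w" ?C] that by blast
    qed
    then have "(\<Sum>w\<in>V. single w (x w)) \<in> vfun.span ?C" by (rule vfun.span_sum)
    then show "x \<in> vfun.span ?C" using vfuns_eq_sum_single[OF fin] x by force
  qed
  have "vfun.dim ?P = card ?C"
    using vfun.basis_card_eq_dim[OF CP PC ind] by simp
  also have "\<dots> = (\<Sum>w\<in>V. card (B w))"
    using sumC[of "\<lambda>_. 1 :: nat"] by simp
  finally show ?thesis using B(4) by simp
qed

lemma dim_linear_injective_image:
  fixes T :: "('v \<Rightarrow> 'f::field ^ 'd) \<Rightarrow> ('v \<Rightarrow> 'f ^ 'd)"
  assumes lin: "Vector_Spaces.linear vfun_scale vfun_scale T"
    and sub: "vfun.subspace W" and inj: "inj_on T W"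
  shows "vfun.dim (T ` W) = vfun.dim W"
proof -
  interpret T: Vector_Spaces.linear vfun_scale vfun_scale T by (rule lin)
  obtain B where B: "B \<subseteq> W" "vfun.independent B" "W \<subseteq> vfun.span B" "card B = vfun.dim W"
    using vfun.basis_exists by metis
  have span: "vfun.span B = W"
    using B sub vfun.span_minimal by blast
  have "vfun.independent (T ` B)"
    using B(2) inj span by (intro T.independent_injective_image) auto
  moreover have "vfun.span (T ` B) = T ` W"
    by (simp add: T.span_image span)
  ultimately have "vfun.dim (T ` W) = card (T ` B)"
    by (metis vfun.dim_span_eq_card_independent)
  also have "\<dots> = card B"
    using B(1) inj by (intro card_image) (rule inj_on_subset)
  finally show ?thesis using B(4) by simp
qed

section \<open>Connected components\<close>

lemma two_way_simps [simp]:
  "verts (two_way G X) = verts G" "arcs (two_way G X) = X \<times> UNIV"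
  "tail (two_way G X) (e, b) = (if b then tail G e else head G e)"
  "head (two_way G X) (e, b) = (if b then head G e else tail G e)"
  by (simp_all add: two_way_def)

lemma edge_subgraph_simps [simp]:
  "verts (edge_subgraph G F) = endverts G F" "arcs (edge_subgraph G F) = F"
  "tail (edge_subgraph G F) = tail G" "head (edge_subgraph G F) = head G"
  by (simp_all add: edge_subgraph_def)

lemma wf_two_way:
  assumes "wf_digraph G" "X \<subseteq> arcs G"
  shows "wf_digraph (two_way G X)"
proof -
  interpret wf_digraph G by fact
  show ?thesis using assms(2) by unfold_locales (auto split: if_splits)
qed

lemma wf_edge_subgraph: "wf_digraph (edge_subgraph G F)"
  by unfold_locales (auto simp: endverts_def)

text \<open>\<open>mk_symmetric\<close> merges parallel arcs while \<open>two_way\<close> keeps them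
  apart with their gains; reachability sees only the pairs of ends, and these agree. Hence
  undirected reachability can be witnessed by walks that carry gains.\<close>

lemma arcs_ends_two_way:
  fixes G :: "('v, 'e) pre_digraph"
  shows "arcs_ends (two_way G (arcs G)) = arcs_ends (with_proj (mk_symmetric G))"
proof -
  have times_bool: "X \<times> (UNIV :: bool set) = (\<Union>e\<in>X. {(e, True), (e, False)})" for X :: "'e set"
    by (auto simp: UNIV_bool)
  show ?thesis
    by (simp add: arcs_ends_def arc_to_ends_def parcs_mk_symmetric times_bool image_UN)
qed

lemma reachable_mk_symmetric_iff_walk:
  assumes "wf_digraph G"
  shows "u \<rightarrow>\<^sup>*\<^bsub>mk_symmetric G\<^esub> v \<longleftrightarrow> (\<exists>p. pre_digraph.awalk (two_way G (arcs G)) u p v)"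
proof -
  interpret T: wf_digraph "two_way G (arcs G)" using assms by (rule wf_two_way) simp
  have "u \<rightarrow>\<^sup>*\<^bsub>mk_symmetric G\<^esub> v \<longleftrightarrow> u \<rightarrow>\<^sup>*\<^bsub>two_way G (arcs G)\<^esub> v"
    by (simp add: reachable_def arcs_ends_two_way)
  then show ?thesis by (simp add: T.reachable_awalk)
qed

text \<open>Testing the tail is enough in a well-formed digraph: the two ends of an arc are
  reachable from the same vertices.\<close>

definition comp_arcs :: "('v, 'e) pre_digraph \<Rightarrow> 'v \<Rightarrow> 'e set" where
  "comp_arcs H w = {e \<in> arcs H. w \<rightarrow>\<^sup>*\<^bsub>mk_symmetric H\<^esub> tail H e}"

definition comp_graph :: "('v, 'e) pre_digraph \<Rightarrow> 'v \<Rightarrow> ('v, 'e) pre_digraph" where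
  "comp_graph H w = \<lparr> verts = {u. w \<rightarrow>\<^sup>*\<^bsub>mk_symmetric H\<^esub> u}, arcs = comp_arcs H w,
     tail = tail H, head = head H \<rparr>"

lemma comp_graph_simps [simp]:
  "verts (comp_graph H w) = {u. w \<rightarrow>\<^sup>*\<^bsub>mk_symmetric H\<^esub> u}"
  "arcs (comp_graph H w) = comp_arcs H w"
  "tail (comp_graph H w) = tail H" "head (comp_graph H w) = head H"
  by (simp_all add: comp_graph_def)

context wf_digraph
begin

lemma mk_symmetric_reachable_refl: "v \<in> verts G \<Longrightarrow> v \<rightarrow>\<^sup>*\<^bsub>mk_symmetric G\<^esub> v"
  by (simp add: reachable_def)

lemma mk_symmetric_reachable_trans:
  "u \<rightarrow>\<^sup>*\<^bsub>mk_symmetric G\<^esub> v \<Longrightarrow> v \<rightarrow>\<^sup>*\<^bsub>mk_symmetric G\<^esub> w \<Longrightarrow> u \<rightarrow>\<^sup>*\<^bsub>mk_symmetric G\<^esub> w"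
  unfolding reachable_def by (rule rtrancl_on_trans)

lemma mk_symmetric_reachable_sym:
  "u \<rightarrow>\<^sup>*\<^bsub>mk_symmetric G\<^esub> v \<Longrightarrow> v \<rightarrow>\<^sup>*\<^bsub>mk_symmetric G\<^esub> u"
  by (rule symmetric_reachable[OF symmetric_mk_symmetric])

lemma mk_symmetric_reachable_arc:
  assumes "e \<in> arcs G"
  shows "tail G e \<rightarrow>\<^sup>*\<^bsub>mk_symmetric G\<^esub> head G e"
proof -
  interpret S: pair_wf_digraph "mk_symmetric G" ..
  show ?thesis
    by (rule S.reachable_adjI) (use assms in \<open>auto simp: parcs_mk_symmetric\<close>)
qed

lemma mk_symmetric_reachable_tail_iff_head:
  assumes "e \<in> arcs G"
  shows "w \<rightarrow>\<^sup>*\<^bsub>mk_symmetric G\<^esub> tail G e \<longleftrightarrow> w \<rightarrow>\<^sup>*\<^bsub>mk_symmetric G\<^esub> head G e"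
  using mk_symmetric_reachable_arc[OF assms]
  by (meson mk_symmetric_reachable_sym mk_symmetric_reachable_trans)

lemma mk_symmetric_reachable_in_verts:
  "u \<rightarrow>\<^sup>*\<^bsub>mk_symmetric G\<^esub> v \<Longrightarrow> u \<in> verts G \<and> v \<in> verts G"
  by (erule reachable_in_vertsE) simp

lemma wf_comp_graph: "wf_digraph (comp_graph G w)"
  by unfold_locales (auto simp: comp_arcs_def mk_symmetric_reachable_tail_iff_head)

lemma comp_graph_subgraph: "subgraph (comp_graph G w) G"
  unfolding subgraph_def
  using wf_comp_graph wf_digraph mk_symmetric_reachable_in_verts
  by (auto simp: compatible_def comp_arcs_def)

text \<open>A walk that starts in the class of \<open>w\<close> never leaves it, so it uses only
  arcs of the component and is also a walk there.\<close>

lemma comp_graph_connected: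
  assumes "w \<in> verts G"
  shows "connected (comp_graph G w)"
proof -
  interpret K: wf_digraph "comp_graph G w" by (rule wf_comp_graph)
  interpret T: wf_digraph "two_way G (arcs G)" using wf_digraph by (rule wf_two_way) simp
  interpret KT: wf_digraph "two_way (comp_graph G w) (comp_arcs G w)"
    using K.wf_digraph by (rule wf_two_way) simp
  have walk: "KT.awalk u p v"
    if "T.awalk u p v" "w \<rightarrow>\<^sup>*\<^bsub>mk_symmetric G\<^esub> u" for u p v
    using that
  proof (induction p arbitrary: u)
    case Nil
    then show ?case by (auto simp: T.awalk_Nil_iff KT.awalk_Nil_iff)
  next
    case (Cons a p)
    obtain e b where a: "a = (e, b)" by (cases a)
    from Cons.prems a have e: "e \<in> arcs G" and u: "u = (if b then tail G e else head G e)"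
      and p: "T.awalk (if b then head G e else tail G e) p v"
      by (auto simp: T.awalk_Cons_iff)
    have w: "w \<rightarrow>\<^sup>*\<^bsub>mk_symmetric G\<^esub> tail G e" "w \<rightarrow>\<^sup>*\<^bsub>mk_symmetric G\<^esub> head G e"
      using Cons.prems(2) u mk_symmetric_reachable_tail_iff_head[OF e, of w] by (auto split: if_splits)
    then have "KT.awalk (if b then head G e else tail G e) p v"
      using Cons.IH[OF p] by simp
    moreover have "e \<in> comp_arcs G w"
      using e w by (simp add: comp_arcs_def)
    ultimately show ?case
      using u a by (cases b) (simp_all add: KT.awalk_Cons_iff)
  qed
  have "u \<rightarrow>\<^sup>*\<^bsub>mk_symmetric (comp_graph G w)\<^esub> v"
    if "w \<rightarrow>\<^sup>*\<^bsub>mk_symmetric G\<^esub> u" "w \<rightarrow>\<^sup>*\<^bsub>mk_symmetric G\<^esub> v" for u v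
  proof -
    have "u \<rightarrow>\<^sup>*\<^bsub>mk_symmetric G\<^esub> v"
      using that mk_symmetric_reachable_sym mk_symmetric_reachable_trans by blast
    then obtain p where "T.awalk u p v"
      using reachable_mk_symmetric_iff_walk wf_digraph by metis
    then have "KT.awalk u p v" using walk that(1) by blast
    then show ?thesis
      using reachable_mk_symmetric_iff_walk[OF K.wf_digraph] by auto
  qed
  then show ?thesis
    using mk_symmetric_reachable_refl[OF assms]
    by (auto simp: connected_def strongly_connected_def)
qed

text \<open>Undirected reachability can only grow from \<open>H\<close> to \<open>G\<close>, so all
  of \<open>H\<close> lies in the class of \<open>w\<close>.\<close>

lemma connected_subgraph_le_comp_graph:
  assumes "subgraph H G" "connected H" "w \<in> verts H"
  shows "subgraph H (comp_graph G w)"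
proof -
  have reach: "w \<rightarrow>\<^sup>*\<^bsub>mk_symmetric G\<^esub> u" if "u \<in> verts H" for u
  proof -
    have "w \<rightarrow>\<^sup>*\<^bsub>mk_symmetric H\<^esub> u"
      using assms(2,3) that by (auto simp: connected_def strongly_connected_def)
    then show ?thesis
      by (rule pre_digraph.reachable_mono) (rule subgraph_mk_symmetric[OF assms(1)])
  qed
  have H: "verts H \<subseteq> verts G" "arcs H \<subseteq> arcs G" "wf_digraph H" "tail G = tail H" "head G = head H"
    using assms(1) by (auto simp: subgraph_def compatible_def)
  have "arcs H \<subseteq> comp_arcs G w"
    using H reach wf_digraph.tail_in_verts[OF H(3)] by (auto simp: comp_arcs_def)
  then show ?thesis
    using H reach wf_comp_graph by (auto simp: subgraph_def compatible_def)
qed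

lemma subgraph_antisym: "subgraph H K \<Longrightarrow> subgraph K H \<Longrightarrow> H = K"
  for H K :: "('v, 'e) pre_digraph"
  by (auto simp: subgraph_def compatible_def intro!: pre_digraph.equality)

text \<open>Among the connected subgraphs through \<open>w\<close>, \<open>comp_graph G w\<close> is
  the largest. A maximal one must therefore equal it, and a connected subgraph above it still
  contains \<open>w\<close> and so lies below it.\<close>

lemma max_connected_subgraphs_eq: "{H. max_subgraph connected H} = comp_graph G ` verts G"
proof (intro equalityI subsetI)
  fix H assume "H \<in> {H. max_subgraph connected H}"
  then have H: "subgraph H G" "connected H"
    and max: "\<And>H'. subgraph H H' \<Longrightarrow> subgraph H' G \<Longrightarrow> connected H' \<Longrightarrow> H' = H"
    by (auto simp: max_subgraph_def)
  then obtain w where w: "w \<in> verts H" by (auto simp: connected_def strongly_connected_def)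
  then have wG: "w \<in> verts G" using H(1) by (auto simp: subgraph_def)
  have "comp_graph G w = H"
    by (rule max[OF connected_subgraph_le_comp_graph[OF H w] comp_graph_subgraph
          comp_graph_connected[OF wG]])
  then show "H \<in> comp_graph G ` verts G" using wG by blast
next
  fix H assume "H \<in> comp_graph G ` verts G"
  then obtain w where w: "w \<in> verts G" "H = comp_graph G w" by blast
  have "w \<in> verts H" using w mk_symmetric_reachable_refl by simp
  have "H' = H" if "subgraph H H'" "subgraph H' G" "connected H'" for H'
  proof (rule subgraph_antisym)
    have "w \<in> verts H'" using that(1) \<open>w \<in> verts H\<close> by (auto simp: subgraph_def)
    then show "subgraph H' H" using connected_subgraph_le_comp_graph that w by blast
  qed (rule that(1))
  then show "H \<in> {H. max_subgraph connected H}"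
    using w comp_graph_subgraph comp_graph_connected by (auto simp: max_subgraph_def)
qed

end

lemma edge_components_eq:
  "edge_components G F = comp_arcs (edge_subgraph G F) ` endverts G F"
proof -
  interpret H: wf_digraph "edge_subgraph G F" by (rule wf_edge_subgraph)
  show ?thesis
    unfolding edge_components_def H.max_connected_subgraphs_eq by (simp add: image_image)
qed

text \<open>An edge subgraph has no isolated vertices, so every vertex of a class is an end of one
  of its arcs. The arc set of a component thus determines its vertices.\<close>

lemma endverts_comp_arcs:
  assumes "w \<in> endverts G F"
  shows "endverts G (comp_arcs (edge_subgraph G F) w) =
    {u. w \<rightarrow>\<^sup>*\<^bsub>mk_symmetric (edge_subgraph G F)\<^esub> u}" (is "_ = ?R")
proof -
  interpret H: wf_digraph "edge_subgraph G F" by (rule wf_edge_subgraph)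
  show ?thesis
  proof (intro equalityI subsetI)
    fix u assume "u \<in> endverts G (comp_arcs (edge_subgraph G F) w)"
    then obtain e where e: "e \<in> comp_arcs (edge_subgraph G F) w" "u = tail G e \<or> u = head G e"
      by (auto simp: endverts_def)
    then show "u \<in> ?R"
      using H.mk_symmetric_reachable_tail_iff_head[of e w] by (auto simp: comp_arcs_def)
  next
    fix u assume u: "u \<in> ?R"
    then have "u \<in> endverts G F" using H.mk_symmetric_reachable_in_verts by fastforce
    then obtain e where e: "e \<in> F" "u = tail G e \<or> u = head G e" by (auto simp: endverts_def)
    then have "w \<rightarrow>\<^sup>*\<^bsub>mk_symmetric (edge_subgraph G F)\<^esub> tail G e"
      using u H.mk_symmetric_reachable_tail_iff_head[of e w] by auto
    then have "e \<in> comp_arcs (edge_subgraph G F) w"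
      using e(1) by (simp add: comp_arcs_def)
    then show "u \<in> endverts G (comp_arcs (edge_subgraph G F) w)"
      using e(2) by (auto simp: endverts_def)
  qed
qed

section \<open>Gains of walks\<close>

lemma linear_vec_mult: "Vector_Spaces.linear (*s) (*s) ((*v) (A :: 'f::field ^ 'n ^ 'm))"
  by (rule matrix_vector_mul_linear_gen)

lemma mult_vec_scale: "A *v (c *s x) = c *s (A *v x)" for A :: "'f::field ^ 'n ^ 'm"
  using linear_vec_mult by (rule vec.linear_scale)

lemma mult_vec_minus: "A *v (- x) = - (A *v x)" for A :: "'f::field ^ 'n ^ 'm"
  using linear_vec_mult by (rule vec.linear_neg)

text \<open>The vertex set enters \<open>awalk\<close> only through the starting vertex. This moves
  walks between \<open>G\<close> and its edge subgraph, which lacks the isolated vertices of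
  \<open>G\<close>.\<close>

lemma awalk_two_way_cong:
  assumes "tail G = tail G'" "head G = head G'" "u \<in> verts G" "u \<in> verts G'"
  shows "pre_digraph.awalk (two_way G X) u p v \<longleftrightarrow> pre_digraph.awalk (two_way G' X) u p v"
proof -
  have ends: "tail (two_way G X) = tail (two_way G' X)" "head (two_way G X) = head (two_way G' X)"
    by (simp_all only: two_way_def assms(1,2) pre_digraph.simps)
  have "pre_digraph.cas (two_way G X) u p v = pre_digraph.cas (two_way G' X) u p v" for u
    by (induction p arbitrary: u) (simp_all only: pre_digraph.cas.simps ends)
  then show ?thesis using assms by (simp add: pre_digraph.awalk_def)
qed

section \<open>Walks and their gains in a fixed gain graph with a representation\<close>

locale gain_graph = group \<Gamma> + fin_digraph G
  for \<Gamma> :: "('g, 'm) monoid_scheme" (structure) and G :: "('v, 'e) pre_digraph" +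
  fixes \<rho> :: "'g \<Rightarrow> 'f::field ^ 'd ^ 'd" and \<psi> :: "'e \<Rightarrow> 'g"
  assumes rep: "\<rho> \<in> hom \<Gamma> GL"
    and gain: "\<psi> \<in> arcs G \<rightarrow> carrier \<Gamma>"
begin

text \<open>Isolated vertices are left out: every element of an edge space vanishes there, and the
  rank function does not count them.\<close>

abbreviation "verts\<^sub>0 \<equiv> endverts G (arcs G)"
abbreviation "walk \<equiv> pre_digraph.awalk (two_way G (arcs G))"
abbreviation "linked u v \<equiv> u \<rightarrow>\<^sup>*\<^bsub>mk_symmetric (edge_subgraph G (arcs G))\<^esub> v"
abbreviation "component w \<equiv> comp_arcs (edge_subgraph G (arcs G)) w"
abbreviation "gain_of \<equiv> walk_gain \<Gamma> \<psi>"

sublocale D: wf_digraph "two_way G (arcs G)"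
  by (rule wf_two_way[OF wf_digraph]) simp

sublocale H: wf_digraph "edge_subgraph G (arcs G)"
  by (rule wf_edge_subgraph)

lemma rep_mult:
  assumes "g \<in> carrier \<Gamma>" "h \<in> carrier \<Gamma>"
  shows "\<rho> (g \<otimes> h) *v a = \<rho> g *v (\<rho> h *v a)"
  using rep assms by (simp add: hom_def GL_def matrix_vector_mul_assoc)

text \<open>The matrix \<open>\<rho> \<one>\<close> is idempotent and invertible, hence the
  identity.\<close>

lemma rep_one: "\<rho> \<one> = mat 1"
proof -
  have "\<rho> \<one> ** \<rho> \<one> = \<rho> \<one>" "invertible (\<rho> \<one>)"
    using rep by (auto simp: hom_def GL_def Pi_iff) (metis one_closed r_one)
  then show ?thesis
    by (metis invertible_def matrix_mul_assoc matrix_mul_lid)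
qed

lemma rep_inv:
  assumes "g \<in> carrier \<Gamma>"
  shows "\<rho> g *v (\<rho> (inv g) *v a) = a" "\<rho> (inv g) *v (\<rho> g *v a) = a"
  using assms by (simp_all flip: rep_mult add: rep_one)

lemma arc_gain_closed: "e \<in> arcs G \<Longrightarrow> arc_gain \<Gamma> \<psi> (e, b) \<in> carrier \<Gamma>"
  using gain by (auto simp: arc_gain_def Pi_iff)

lemma gain_of_Nil [simp]: "gain_of [] = \<one>"
  by (simp add: walk_gain_def)

lemma gain_of_Cons [simp]: "gain_of (a # p) = arc_gain \<Gamma> \<psi> a \<otimes> gain_of p"
  by (simp add: walk_gain_def)

lemma gain_of_closed: "set p \<subseteq> arcs G \<times> UNIV \<Longrightarrow> gain_of p \<in> carrier \<Gamma>"
  by (induction p) (auto intro: arc_gain_closed)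

lemma gain_of_append:
  "set p \<subseteq> arcs G \<times> UNIV \<Longrightarrow> set q \<subseteq> arcs G \<times> UNIV \<Longrightarrow> gain_of (p @ q) = gain_of p \<otimes> gain_of q"
  by (induction p) (auto simp: m_assoc arc_gain_closed gain_of_closed)

lemma walk_arcs: "walk u p v \<Longrightarrow> set p \<subseteq> arcs G \<times> UNIV"
  by (auto simp: D.awalk_def)

lemma walk_gain_closed: "walk u p v \<Longrightarrow> gain_of p \<in> carrier \<Gamma>"
  by (rule gain_of_closed[OF walk_arcs])

text \<open>The reversed walk takes the arcs in the opposite order with each direction flag flipped,
  which inverts the product of the gains.\<close>

lemma walk_reverse:
  assumes "walk u p v"
  shows "\<exists>q. walk v q u \<and> gain_of q = inv (gain_of p)"
  using assms
proof (induction p arbitrary: u)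
  case Nil
  then have "walk v [] u" by (auto simp: D.awalk_Nil_iff)
  then show ?case by (intro exI[of _ "[]"]) simp
next
  case (Cons a p)
  obtain e b where a: "a = (e, b)" by (cases a)
  let ?u = "if b then head G e else tail G e"
  from Cons.prems a have e: "e \<in> arcs G" and u: "u = (if b then tail G e else head G e)"
    and p: "walk ?u p v"
    by (auto simp: D.awalk_Cons_iff)
  from Cons.IH[OF p] obtain q where q: "walk v q ?u" "gain_of q = inv (gain_of p)" by blast
  have flipped: "walk ?u [(e, \<not> b)] u"
    using e u by (auto simp: D.awalk_Cons_iff D.awalk_Nil_iff)
  have gb: "arc_gain \<Gamma> \<psi> (e, \<not> b) = inv (arc_gain \<Gamma> \<psi> (e, b))"
    using gain e by (auto simp: arc_gain_def Pi_iff)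
  have "gain_of (q @ [(e, \<not> b)]) = inv (gain_of (a # p))"
    using e q arc_gain_closed[OF e] walk_gain_closed[OF p] walk_arcs[OF q(1)]
    by (simp add: gain_of_append a gb inv_mult_group)
  then show ?case using D.awalk_appendI[OF q(1) flipped] by blast
qed

lemma finite_verts0: "finite verts\<^sub>0"
  by (simp add: endverts_def)

lemma verts0_subset: "verts\<^sub>0 \<subseteq> verts G"
  by (auto simp: endverts_def)

text \<open>The hypothesis on \<open>u\<close> excludes isolated vertices of \<open>G\<close>, which
  have an empty walk but do not belong to the edge subgraph.\<close>

lemma linked_iff_walk:
  assumes "u \<in> verts\<^sub>0"
  shows "linked u v \<longleftrightarrow> (\<exists>p. walk u p v)"
proof -
  have "linked u v \<longleftrightarrow>
      (\<exists>p. pre_digraph.awalk (two_way (edge_subgraph G (arcs G)) (arcs G)) u p v)"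
    using reachable_mk_symmetric_iff_walk[OF wf_edge_subgraph, of G "arcs G" u v]
    by (simp only: edge_subgraph_simps)
  also have "\<dots> \<longleftrightarrow> (\<exists>p. walk u p v)"
    using assms verts0_subset by (subst awalk_two_way_cong[of _ G]) auto
  finally show ?thesis .
qed

section \<open>Components and their roots\<close>

lemma linked_refl: "u \<in> verts\<^sub>0 \<Longrightarrow> linked u u"
  using H.mk_symmetric_reachable_refl by simp

lemma linked_arc: "e \<in> arcs G \<Longrightarrow> linked (tail G e) (head G e)"
  using H.mk_symmetric_reachable_arc by simp

lemma linked_in_verts0: "linked u v \<Longrightarrow> u \<in> verts\<^sub>0 \<and> v \<in> verts\<^sub>0"
  using H.mk_symmetric_reachable_in_verts[of u v] by simp

lemmas linked_sym = H.mk_symmetric_reachable_sym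
lemmas linked_trans = H.mk_symmetric_reachable_trans

text \<open>Walks cannot leave the class in which they start, so deleting the other components
  changes no closed walk there. The gain group of a component can then be computed in the whole
  graph.\<close>

lemma walk_comp_iff:
  assumes "linked w u"
  shows "pre_digraph.awalk (two_way G (component w)) u p v \<longleftrightarrow> walk u p v"
proof -
  have sub: "component w \<subseteq> arcs G" by (auto simp: comp_arcs_def)
  interpret C: wf_digraph "two_way G (component w)" using wf_digraph sub by (rule wf_two_way)
  show ?thesis
    using assms
  proof (induction p arbitrary: u)
    case Nil
    then show ?case by (simp add: C.awalk_Nil_iff D.awalk_Nil_iff)
  next
    case (Cons a p)
    obtain e b where a: "a = (e, b)" by (cases a)
    show ?case
    proof (cases "e \<in> arcs G \<and> u = (if b then tail G e else head G e)")
      case True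
      then have both: "linked w (tail G e)" "linked w (head G e)"
        using Cons.prems H.mk_symmetric_reachable_tail_iff_head[of e w] by (auto split: if_splits)
      then have "e \<in> component w" using True by (simp add: comp_arcs_def)
      then show ?thesis
        using True a Cons.IH[OF both(1)] Cons.IH[OF both(2)]
        by (cases b) (simp_all add: C.awalk_Cons_iff D.awalk_Cons_iff)
    next
      case False
      then show ?thesis
        using a sub by (cases b) (auto simp: C.awalk_Cons_iff D.awalk_Cons_iff)
    qed
  qed
qed

lemma gain_subgroup_comp:
  "linked w u \<Longrightarrow> gain_subgroup \<Gamma> G \<psi> (component w) u = gain_subgroup \<Gamma> G \<psi> (arcs G) u"
  by (simp add: gain_subgroup_def walk_comp_iff)

text \<open>The choice is the same \<open>SOME\<close> term as in \<open>gain_rep_dim\<close>, so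
  the base vertex used there is literally the root, and no conjugation of gain groups has to be
  carried out.\<close>

definition root :: "'v \<Rightarrow> 'v" where
  "root w = (SOME v. v \<in> endverts G (component w))"

lemma linked_root:
  assumes "w \<in> verts\<^sub>0"
  shows "linked w (root w)"
  using someI[of "\<lambda>v. v \<in> endverts G (component w)" w] endverts_comp_arcs[OF assms] linked_refl[OF assms]
  by (simp add: root_def)

lemma comp_eq: "linked u v \<Longrightarrow> component u = component v"
proof -
  assume "linked u v"
  then have "linked u x \<longleftrightarrow> linked v x" for x
    using linked_trans[of u v x] linked_trans[of v u x] linked_sym[of u v] by blast
  then show ?thesis by (simp add: comp_arcs_def)
qed

lemma root_eq_iff:
  assumes "u \<in> verts\<^sub>0" "v \<in> verts\<^sub>0"
  shows "root u = root v \<longleftrightarrow> linked u v"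
proof
  assume "root u = root v"
  then show "linked u v"
    using linked_trans[OF linked_root[OF assms(1)]] linked_sym[OF linked_root[OF assms(2)]] by simp
next
  assume "linked u v"
  then show "root u = root v" using comp_eq by (simp add: root_def)
qed

lemma comp_eq_iff:
  assumes "u \<in> verts\<^sub>0" "v \<in> verts\<^sub>0"
  shows "component u = component v \<longleftrightarrow> root u = root v"
  using root_eq_iff[OF assms] comp_eq by (auto simp: root_def)

lemma root_in_verts0: "w \<in> verts\<^sub>0 \<Longrightarrow> root w \<in> verts\<^sub>0"
  using linked_root linked_in_verts0 by blast

lemma root_root: "w \<in> verts\<^sub>0 \<Longrightarrow> root (root w) = root w"
  using root_eq_iff[OF root_in_verts0, of w w] linked_sym[OF linked_root] by blast

lemma root_tail_head: "e \<in> arcs G \<Longrightarrow> root (tail G e) = root (head G e)"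
  using linked_arc[of e] linked_in_verts0[OF linked_arc] root_eq_iff by blast

text \<open>The walk is an arbitrary choice. By \<open>walk_diff_in_displacement\<close>, another
  choice changes a transported vector only by an element of the displacement space of the
  root.\<close>

definition gain_from_root :: "'v \<Rightarrow> 'g" where
  "gain_from_root w = gain_of (SOME p. walk (root w) p w)"

lemma gain_from_root:
  assumes "w \<in> verts\<^sub>0"
  obtains p where "walk (root w) p w" "gain_of p = gain_from_root w"
proof -
  have "\<exists>p. walk (root w) p w"
    using linked_sym[OF linked_root[OF assms]] linked_iff_walk[OF root_in_verts0[OF assms]] by blast
  then have "walk (root w) (SOME p. walk (root w) p w) w" by (rule someI_ex)
  then show ?thesis by (rule that) (simp add: gain_from_root_def)
qed

lemma gain_from_root_closed: "w \<in> verts\<^sub>0 \<Longrightarrow> gain_from_root w \<in> carrier \<Gamma>"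
  by (erule gain_from_root) (metis walk_gain_closed)

section \<open>The span of the edge spaces\<close>

definition edge_span :: "('v \<Rightarrow> 'f ^ 'd) set" where
  "edge_span = vfun.span (\<Union>e\<in>arcs G. edge_space \<rho> G \<psi> e)"

text \<open>The quotient of the full vector space by this subspace is the space of coinvariants of
  the gain group at \<open>r\<close>.\<close>

definition displacement :: "'v \<Rightarrow> ('f ^ 'd) set" where
  "displacement r =
     vec.span (\<Union>\<gamma>\<in>gain_subgroup \<Gamma> G \<psi> (arcs G) r. range (\<lambda>a. (mat 1 - \<rho> \<gamma>) *v a))"

lemma subspace_edge_span: "vfun.subspace edge_span"
  by (simp add: edge_span_def)

lemma edge_space_subset: "e \<in> arcs G \<Longrightarrow> edge_space \<rho> G \<psi> e \<subseteq> edge_span"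
  unfolding edge_span_def by (auto intro: vfun.span_base)

text \<open>Modulo the edge span, a vector at the head of \<open>e\<close> may be moved to the tail
  by applying \<open>\<rho> (\<psi> e)\<close>. This form covers loops and non-loops alike.\<close>

lemma arc_in_edge_span:
  assumes e: "e \<in> arcs G"
  shows "single (tail G e) (\<rho> (\<psi> e) *v a) - single (head G e) a \<in> edge_span"
proof -
  have "single (tail G e) (\<rho> (\<psi> e) *v a) - single (head G e) a \<in> edge_space \<rho> G \<psi> e"
  proof (cases "tail G e = head G e")
    case True
    have "\<rho> (\<psi> e) *v a - a = (mat 1 - \<rho> (\<psi> e)) *v (- a)"
      by (simp add: matrix_vector_mult_diff_rdistrib mult_vec_minus)
    then show ?thesis
      using True e
      by (auto simp: edge_space_def vfuns_def single_apply Let_def simp flip: single_diff)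
  next
    case False
    then show ?thesis
      using e by (auto simp: edge_space_def vfuns_def single_apply mult_vec_minus Let_def)
  qed
  then show ?thesis using edge_space_subset[OF e] by blast
qed

lemma two_way_arc_in_edge_span:
  assumes e: "e \<in> arcs G"
  shows "single (tail (two_way G (arcs G)) (e, b)) (\<rho> (arc_gain \<Gamma> \<psi> (e, b)) *v a)
    - single (head (two_way G (arcs G)) (e, b)) a \<in> edge_span"
proof (cases b)
  case True
  then show ?thesis using arc_in_edge_span[OF e, of a] by (simp add: arc_gain_def)
next
  case False
  \<comment> \<open>The forward case applied to this vector has \<open>a\<close> at the tail; a
    change of sign then gives the backward case.\<close>
  let ?c = "\<rho> (inv \<psi> e) *v a"
  have "\<rho> (\<psi> e) *v ?c = a"
    using gain e by (auto simp: Pi_iff rep_inv)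
  then have "- (single (head G e) ?c - single (tail G e) a) \<in> edge_span"
    using arc_in_edge_span[OF e, of ?c] by (simp only: minus_diff_eq)
  then have "single (head G e) ?c - single (tail G e) a \<in> edge_span"
    using vfun.subspace_neg[OF subspace_edge_span] by (metis minus_minus)
  then show ?thesis using False by (simp add: arc_gain_def)
qed

text \<open>The differences for single arcs telescope: at each intermediate vertex stands the vector
  \<open>a\<close> transported by the rest of the walk.\<close>

lemma walk_in_edge_span:
  assumes "walk u p v"
  shows "single u (\<rho> (gain_of p) *v a) - single v a \<in> edge_span"
  using assms
proof (induction p arbitrary: u)
  case Nil
  then have "u = v" by (simp add: D.awalk_Nil_iff)
  then show ?case
    using vfun.subspace_0[OF subspace_edge_span]
    by (simp only: gain_of_Nil rep_one matrix_vector_mul_lid diff_self)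
next
  case (Cons x p)
  obtain e b where x: "x = (e, b)" by (cases x)
  let ?u = "head (two_way G (arcs G)) (e, b)"
  from Cons.prems x have e: "e \<in> arcs G" and u: "u = tail (two_way G (arcs G)) (e, b)"
    and p: "walk ?u p v"
    by (auto simp: D.awalk_Cons_iff simp del: two_way_simps(3,4))
  have "(single u (\<rho> (arc_gain \<Gamma> \<psi> x) *v (\<rho> (gain_of p) *v a)) - single ?u (\<rho> (gain_of p) *v a))
      + (single ?u (\<rho> (gain_of p) *v a) - single v a) \<in> edge_span"
    using two_way_arc_in_edge_span[OF e, of b] Cons.IH[OF p] unfolding u x
    by (rule vfun.subspace_add[OF subspace_edge_span])
  moreover have "\<rho> (gain_of (x # p)) *v a = \<rho> (arc_gain \<Gamma> \<psi> x) *v (\<rho> (gain_of p) *v a)"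
    using arc_gain_closed[OF e] walk_gain_closed[OF p] x by (simp add: rep_mult)
  ultimately show ?case by (simp only: diff_add_cancel add_diff_eq)
qed

text \<open>A closed walk with gain \<gamma> carries a vector back to \<open>r\<close>, so its
  difference from its image under \<open>\<rho> \<gamma>\<close> becomes zero modulo the edge
  span.\<close>

lemma displacement_in_edge_span:
  assumes "a \<in> displacement r"
  shows "single r a \<in> edge_span"
proof -
  have gen: "single r a \<in> edge_span"
    if "a \<in> (\<Union>\<gamma>\<in>gain_subgroup \<Gamma> G \<psi> (arcs G) r. range (\<lambda>a. (mat 1 - \<rho> \<gamma>) *v a))" for a
  proof -
    from that obtain p b where p: "walk r p r" and a: "a = (mat 1 - \<rho> (gain_of p)) *v b"
      by (auto simp: gain_subgroup_def)
    have "- (single r (\<rho> (gain_of p) *v b) - single r b) \<in> edge_span"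
      using walk_in_edge_span[OF p] by (rule vfun.subspace_neg[OF subspace_edge_span])
    then show ?thesis
      by (simp only: a matrix_vector_mult_diff_rdistrib matrix_vector_mul_lid single_diff minus_diff_eq)
  qed
  have "single r a \<in> vfun.span (single r `
      (\<Union>\<gamma>\<in>gain_subgroup \<Gamma> G \<psi> (arcs G) r. range (\<lambda>a. (mat 1 - \<rho> \<gamma>) *v a)))"
    using assms unfolding displacement_def by (rule single_in_span)
  also have "\<dots> \<subseteq> edge_span"
    by (rule vfun.span_minimal[OF _ subspace_edge_span]) (use gen in blast)
  finally show ?thesis .
qed

text \<open>Following \<open>p\<close> and then \<open>q\<close> backwards gives a closed walk. If
  \<gamma> is its gain, the difference is \<open>\<rho> \<gamma> - mat 1\<close> applied to
  \<open>\<rho> (gain_of q) *v a\<close>.\<close>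

lemma walk_diff_in_displacement:
  assumes "walk r p u" "walk r q u"
  shows "\<rho> (gain_of p) *v a - \<rho> (gain_of q) *v a \<in> displacement r"
proof -
  obtain q' where q': "walk u q' r" "gain_of q' = inv (gain_of q)"
    using walk_reverse[OF assms(2)] by blast
  have closed: "walk r (p @ q') r"
    using assms(1) q'(1) by (rule D.awalk_appendI)
  let ?b = "\<rho> (gain_of q) *v a"
  have "\<rho> (gain_of (p @ q')) *v ?b = \<rho> (gain_of p) *v a"
    using walk_gain_closed[OF assms(1)] walk_gain_closed[OF assms(2)] q'
    by (simp add: gain_of_append walk_arcs[OF assms(1)] walk_arcs[OF q'(1)] rep_mult rep_inv)
  then have "\<rho> (gain_of p) *v a - ?b = (mat 1 - \<rho> (gain_of (p @ q'))) *v (- ?b)"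
    by (simp add: matrix_vector_mult_diff_rdistrib mult_vec_minus)
  moreover have "gain_of (p @ q') \<in> gain_subgroup \<Gamma> G \<psi> (arcs G) r"
    using closed by (auto simp: gain_subgroup_def)
  ultimately show ?thesis
    unfolding displacement_def by (auto intro!: vec.span_base)
qed

text \<open>The chosen walk to the tail extended by \<open>e\<close>, and the chosen walk to the
  head, are two walks from the same root to the same vertex.\<close>

lemma arc_in_displacement:
  assumes e: "e \<in> arcs G"
  shows "\<rho> (gain_from_root (tail G e)) *v (\<rho> (\<psi> e) *v a)
    - \<rho> (gain_from_root (head G e)) *v a \<in> displacement (root (head G e))"
proof -
  have ends: "tail G e \<in> verts\<^sub>0" "head G e \<in> verts\<^sub>0"
    using e by (auto simp: endverts_def)
  obtain p where p: "walk (root (tail G e)) p (tail G e)" "gain_of p = gain_from_root (tail G e)"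
    by (rule gain_from_root[OF ends(1)])
  obtain q where q: "walk (root (head G e)) q (head G e)" "gain_of q = gain_from_root (head G e)"
    by (rule gain_from_root[OF ends(2)])
  have arc: "walk (tail G e) [(e, True)] (head G e)"
    using e by (simp add: D.awalk_Cons_iff D.awalk_Nil_iff)
  have "walk (root (head G e)) (p @ [(e, True)]) (head G e)"
    using D.awalk_appendI[OF p(1) arc] root_tail_head[OF e] by simp
  from walk_diff_in_displacement[OF this q(1), of a] show ?thesis
    using e walk_arcs[OF p(1)] walk_gain_closed[OF p(1)] arc_gain_closed[OF e, of True]
    by (simp add: gain_of_append rep_mult p q) (simp add: arc_gain_def)
qed

text \<open>The sum sits at the root because moving a vector along an arc changes it only by a
  displacement. The chosen walk from a root to itself need not be empty, so its gain is applied
  there as well.\<close>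

definition gather :: "('v \<Rightarrow> 'f ^ 'd) \<Rightarrow> 'v \<Rightarrow> 'f ^ 'd" where
  "gather x w = (if w \<notin> verts\<^sub>0 then 0
     else if root w = w then \<Sum>u | u \<in> verts\<^sub>0 \<and> root u = w. \<rho> (gain_from_root u) *v x u
     else \<rho> (gain_from_root w) *v x w)"

definition local_space :: "'v \<Rightarrow> ('f ^ 'd) set" where
  "local_space w = (if root w = w then displacement w else UNIV)"

definition local_product :: "('v \<Rightarrow> 'f ^ 'd) set" where
  "local_product = {y \<in> vfuns verts\<^sub>0. \<forall>w\<in>verts\<^sub>0. y w \<in> local_space w}"

section \<open>The edge span as a preimage under gathering\<close>

lemma subspace_local_space: "vec.subspace (local_space w)"
  by (simp add: local_space_def displacement_def)

lemma subspace_local_product: "vfun.subspace local_product"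
  using subspace_local_space
  by (auto simp: local_product_def vfun.subspace_def vfuns_def vfun_scale_def vec.subspace_def)

lemma linear_gather: "Vector_Spaces.linear vfun_scale vfun_scale gather"
proof (unfold_locales)
  fix x y :: "'v \<Rightarrow> 'f ^ 'd" and c :: 'f
  show "gather (x + y) = gather x + gather y"
    by (auto simp: gather_def fun_eq_iff matrix_vector_right_distrib sum.distrib)
  show "gather (vfun_scale c x) = vfun_scale c (gather x)"
    by (auto simp: gather_def fun_eq_iff vfun_scale_def mult_vec_scale vec.scale_sum_right)
qed

lemma gather_in_vfuns: "gather x \<in> vfuns verts\<^sub>0"
  by (simp add: gather_def vfuns_def)

text \<open>Only roots impose a condition. The two ends of \<open>e\<close> have the same root, so
  at any root either neither end contributes or the sum is the negative of an expression from
  \<open>arc_in_displacement\<close>.\<close>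

lemma gather_edge_space:
  assumes e: "e \<in> arcs G" and x: "x \<in> edge_space \<rho> G \<psi> e"
  shows "x \<in> vfuns verts\<^sub>0" "gather x \<in> local_product"
proof -
  let ?i = "tail G e" and ?j = "head G e"
  have ends: "?i \<in> verts\<^sub>0" "?j \<in> verts\<^sub>0"
    using e by (auto simp: endverts_def)
  have supp: "x w = 0" if "w \<noteq> ?i" "w \<noteq> ?j" for w
    using x that by (auto simp: edge_space_def vfuns_def Let_def split: if_splits)
  show "x \<in> vfuns verts\<^sub>0"
    using ends by (auto simp: vfuns_def intro: supp)
  have "gather x r \<in> displacement r" if r: "r \<in> verts\<^sub>0" "root r = r" for r
  proof -
    let ?h = "\<lambda>u. \<rho> (gain_from_root u) *v x u"
    have "gather x r = (\<Sum>u | u \<in> verts\<^sub>0 \<and> root u = r. ?h u)"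
      using r by (simp add: gather_def)
    \<comment> \<open>The index is a set, so the single end of a loop is counted once.\<close>
    also have "\<dots> = (\<Sum>u\<in>{?i, ?j} \<inter> {u. root u = r}. ?h u)"
      using ends finite_verts0
      by (intro sum.mono_neutral_right) (auto, metis supp matrix_vector_mult_0_right)
    finally have sum: "gather x r = (\<Sum>u\<in>{?i, ?j} \<inter> {u. root u = r}. ?h u)" .
    show ?thesis
    proof (cases "root ?j = r")
      case False
      then have "{?i, ?j} \<inter> {u. root u = r} = {}" using root_tail_head[OF e] by auto
      then show ?thesis by (simp add: sum displacement_def vec.span_zero)
    next
      case True
      then have inter: "{?i, ?j} \<inter> {u. root u = r} = {?i, ?j}" using root_tail_head[OF e] by auto
      have pair: "gather x r = (\<Sum>u\<in>{?i, ?j}. ?h u)"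
        by (simp only: sum inter)
      \<comment> \<open>For a loop, \<open>a\<close> is the parameter from the definition of its
        edge space; otherwise it is the value of \<open>x\<close> at the head.\<close>
      have "\<exists>a. gather x r = - (\<rho> (gain_from_root ?i) *v (\<rho> (\<psi> e) *v a)
          - \<rho> (gain_from_root ?j) *v a)"
      proof (cases "?i = ?j")
        case True
        then obtain a where "x ?j = (mat 1 - \<rho> (\<psi> e)) *v a"
          using x by (auto simp: edge_space_def Let_def)
        then have "gather x r = - (\<rho> (gain_from_root ?i) *v (\<rho> (\<psi> e) *v a)
            - \<rho> (gain_from_root ?j) *v a)"
          using True
          by (simp add: pair matrix_vector_mult_diff_rdistrib matrix_vector_mult_diff_distrib)
        then show ?thesis by blast
      next
        case False
        then have "x ?i + \<rho> (\<psi> e) *v x ?j = 0"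
          using x by (simp add: edge_space_def Let_def)
        then have "x ?i = - (\<rho> (\<psi> e) *v x ?j)"
          by (rule eq_neg_iff_add_eq_0[THEN iffD2])
        then have "gather x r = - (\<rho> (gain_from_root ?i) *v (\<rho> (\<psi> e) *v x ?j)
            - \<rho> (gain_from_root ?j) *v x ?j)"
          using False by (simp add: pair mult_vec_minus)
        then show ?thesis by blast
      qed
      then show ?thesis
        using arc_in_displacement[OF e] True vec.span_neg unfolding displacement_def by metis
    qed
  qed
  then show "gather x \<in> local_product"
    using gather_in_vfuns by (auto simp: local_product_def local_space_def)
qed

text \<open>Modulo the edge span, each value of \<open>x\<close> may be transported to its root.
  Grouped by root, the transported values add up to the values of \<open>gather x\<close> at the
  roots, which are displacements and so lie in the edge span.\<close>

lemma vfuns_verts0_gatherI: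
  assumes x: "x \<in> vfuns verts\<^sub>0" and tx: "gather x \<in> local_product"
  shows "x \<in> edge_span"
proof -
  let ?h = "\<lambda>w. \<rho> (gain_from_root w) *v x w"
  let ?R = "root ` verts\<^sub>0"
  have step: "single (root w) (?h w) - single w (x w) \<in> edge_span" if w: "w \<in> verts\<^sub>0" for w
    using gain_from_root[OF w] walk_in_edge_span by metis
  have at_root: "single r (gather x r) \<in> edge_span" if "r \<in> ?R" for r
  proof (rule displacement_in_edge_span)
    from that have "r \<in> verts\<^sub>0" "root r = r" using root_in_verts0 root_root by auto
    then show "gather x r \<in> displacement r"
      using tx by (auto simp: local_product_def local_space_def)
  qed
  have "(\<Sum>w\<in>verts\<^sub>0. single (root w) (?h w)) =
      (\<Sum>r\<in>?R. \<Sum>w | w \<in> verts\<^sub>0 \<and> root w = r. single (root w) (?h w))"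
    using finite_verts0 by (intro sum.group[symmetric]) auto
  also have "\<dots> = (\<Sum>r\<in>?R. single r (gather x r))"
  proof (rule sum.cong[OF refl])
    fix r assume "r \<in> ?R"
    then have "r \<in> verts\<^sub>0" "root r = r" using root_in_verts0 root_root by auto
    then show "(\<Sum>w | w \<in> verts\<^sub>0 \<and> root w = r. single (root w) (?h w)) = single r (gather x r)"
      by (simp add: gather_def single_sum)
  qed
  finally have "(\<Sum>r\<in>?R. single r (gather x r)) - (\<Sum>w\<in>verts\<^sub>0. single (root w) (?h w) - single w (x w))
      = (\<Sum>w\<in>verts\<^sub>0. single w (x w))"
    by (simp only: sum_subtractf diff_diff_eq2 add_diff_cancel_left')
  then have "x = (\<Sum>r\<in>?R. single r (gather x r))
      - (\<Sum>w\<in>verts\<^sub>0. single (root w) (?h w) - single w (x w))"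
    using vfuns_eq_sum_single[OF finite_verts0 x] by metis
  also have "\<dots> \<in> edge_span"
    by (rule vfun.subspace_diff[OF subspace_edge_span];
        rule vfun.subspace_sum[OF subspace_edge_span]; fact step at_root)
  finally show ?thesis .
qed

lemma edge_span_eq: "edge_span = {x \<in> vfuns verts\<^sub>0. gather x \<in> local_product}"
proof
  interpret T: Vector_Spaces.linear vfun_scale vfun_scale gather by (rule linear_gather)
  have "vfun.subspace (vfuns verts\<^sub>0 \<inter> gather -` local_product)"
    by (intro vfun.subspace_inter subspace_vfuns T.subspace_vimage subspace_local_product)
  then have "edge_span \<subseteq> vfuns verts\<^sub>0 \<inter> gather -` local_product"
    unfolding edge_span_def
    by (rule vfun.span_minimal[rotated]) (use gather_edge_space in blast)
  then show "edge_span \<subseteq> {x \<in> vfuns verts\<^sub>0. gather x \<in> local_product}" by auto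
qed (use vfuns_verts0_gatherI in blast)

text \<open>With the term of the root split off, \<open>gather\<close> is visibly triangular with
  invertible diagonal blocks: the values at non-roots are determined first, then those at the
  roots.\<close>

lemma sum_at_root:
  assumes "r \<in> verts\<^sub>0" "root r = r"
  shows "gather x r = \<rho> (gain_from_root r) *v x r
    + (\<Sum>u | u \<in> verts\<^sub>0 - {r} \<and> root u = r. \<rho> (gain_from_root u) *v x u)"
proof -
  have "{u \<in> verts\<^sub>0. root u = r} = insert r {u \<in> verts\<^sub>0 - {r}. root u = r}"
    using assms by auto
  then show ?thesis
    using assms finite_verts0 by (simp add: gather_def)
qed

lemma gather_inj: "inj_on gather (vfuns verts\<^sub>0)"
proof -
  interpret T: Vector_Spaces.linear vfun_scale vfun_scale gather by (rule linear_gather)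
  show ?thesis
  proof (subst T.inj_on_iff_eq_0[OF subspace_vfuns], intro ballI impI)
    fix x assume x: "x \<in> vfuns verts\<^sub>0" and z: "gather x = 0"
    have zero: "x w = 0" if w: "w \<in> verts\<^sub>0" "\<rho> (gain_from_root w) *v x w = 0" for w
      using rep_inv(2)[OF gain_from_root_closed[OF w(1)], of "x w"] w(2) by simp
    have nonroot: "x w = 0" if "w \<in> verts\<^sub>0" "root w \<noteq> w" for w
      using fun_cong[OF z, of w] that by (intro zero) (auto simp: gather_def)
    have "x r = 0" if r: "r \<in> verts\<^sub>0" "root r = r" for r
    proof (rule zero[OF r(1)])
      have "(\<Sum>u | u \<in> verts\<^sub>0 - {r} \<and> root u = r. \<rho> (gain_from_root u) *v x u) = 0"
        by (rule sum.neutral) (auto simp: nonroot)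
      then show "\<rho> (gain_from_root r) *v x r = 0"
        using fun_cong[OF z, of r] sum_at_root[OF r, of x] by simp
    qed
    then show "x = 0" using nonroot x by (auto simp: fun_eq_iff vfuns_def)
  qed
qed

lemma gather_surj:
  assumes y: "y \<in> vfuns verts\<^sub>0"
  obtains x where "x \<in> vfuns verts\<^sub>0" "gather x = y"
proof
  let ?lift = "\<lambda>w a. \<rho> (inv (gain_from_root w)) *v a"
  \<comment> \<open>Back substitution: at a non-root \<open>u\<close> the transported value must be
    \<open>y u\<close>, so the root has to supply what remains of \<open>y w\<close> after these are
    subtracted.\<close>
  let ?x = "\<lambda>w. if w \<notin> verts\<^sub>0 then 0
    else if root w = w then ?lift w (y w - (\<Sum>u | u \<in> verts\<^sub>0 - {w} \<and> root u = w. y u))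
    else ?lift w (y w)"
  show "?x \<in> vfuns verts\<^sub>0" by (simp add: vfuns_def)
  have lift: "\<rho> (gain_from_root w) *v ?lift w a = a" if "w \<in> verts\<^sub>0" for w a
    using rep_inv(1) gain_from_root_closed[OF that] by blast
  show "gather ?x = y"
  proof
    fix w
    consider "w \<notin> verts\<^sub>0" | "w \<in> verts\<^sub>0" "root w \<noteq> w" | "w \<in> verts\<^sub>0" "root w = w" by blast
    then show "gather ?x w = y w"
    proof cases
      case 1
      then show ?thesis using y by (simp add: gather_def vfuns_def)
    next
      case 2
      then show ?thesis by (simp add: gather_def lift)
    next
      case 3
      have "(\<Sum>u | u \<in> verts\<^sub>0 - {w} \<and> root u = w. \<rho> (gain_from_root u) *v ?x u) =
          (\<Sum>u | u \<in> verts\<^sub>0 - {w} \<and> root u = w. y u)"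
        by (intro sum.cong refl) (auto simp: lift)
      then show ?thesis
        using 3 by (simp add: sum_at_root[OF 3] lift)
    qed
  qed
qed

section \<open>Transfer to the local product and dimension count\<close>

lemma gather_image: "gather ` edge_span = local_product"
proof (intro equalityI subsetI)
  fix y assume y: "y \<in> local_product"
  then have "y \<in> vfuns verts\<^sub>0" by (simp add: local_product_def)
  then obtain x where "x \<in> vfuns verts\<^sub>0" "gather x = y" by (rule gather_surj)
  then show "y \<in> gather ` edge_span" using y by (auto simp: edge_span_eq)
qed (auto simp: edge_span_eq)

lemma dim_edge_span: "vfun.dim edge_span = (\<Sum>w\<in>verts\<^sub>0. vec.dim (local_space w))"
proof -
  have "inj_on gather edge_span"
    by (rule inj_on_subset[OF gather_inj]) (auto simp: edge_span_eq)
  then have "vfun.dim edge_span = vfun.dim local_product"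
    using dim_linear_injective_image[OF linear_gather subspace_edge_span] gather_image by simp
  also have "\<dots> = (\<Sum>w\<in>verts\<^sub>0. vec.dim (local_space w))"
    unfolding local_product_def by (rule dim_pointwise_subspaces[OF finite_verts0 subspace_local_space])
  finally show ?thesis .
qed

lemma gain_rep_dim_component:
  assumes "w \<in> verts\<^sub>0"
  shows "gain_rep_dim \<Gamma> \<rho> G \<psi> (component w) = vec.dim (displacement (root w))"
  using gain_subgroup_comp[OF linked_root[OF assms]]
  by (simp add: gain_rep_dim_def rep_dim_def displacement_def root_def)

text \<open>The roots index the components bijectively, and each contributes the representation
  dimension of its component. Every other vertex contributes the full dimension, and their number is
  the number of vertices minus that of components.\<close>

lemma gain_rank_eq: "gain_rank \<Gamma> \<rho> G \<psi> (arcs G) = int (vfun.dim edge_span)"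
proof -
  let ?R = "{w \<in> verts\<^sub>0. root w = w}"
  have comps: "edge_components G (arcs G) = component ` ?R"
  proof -
    have "component w \<in> component ` ?R" if w: "w \<in> verts\<^sub>0" for w
      using comp_eq[OF linked_root[OF w]] root_in_verts0[OF w] root_root[OF w] by auto
    then show ?thesis unfolding edge_components_eq by auto
  qed
  \<comment> \<open>Equal components have equal roots, and the elements of \<open>?R\<close> are
    their own roots.\<close>
  have inj: "inj_on component ?R"
    by (rule inj_onI) (use comp_eq_iff in auto)
  have "vfun.dim edge_span = (\<Sum>w\<in>?R. vec.dim (local_space w))
      + (\<Sum>w\<in>verts\<^sub>0 - ?R. vec.dim (local_space w))"
    unfolding dim_edge_span using finite_verts0
    by (subst sum.subset_diff[of ?R]) (auto simp: add.commute)
  also have "(\<Sum>w\<in>?R. vec.dim (local_space w)) = (\<Sum>w\<in>?R. gain_rep_dim \<Gamma> \<rho> G \<psi> (component w))"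
    by (intro sum.cong refl) (auto simp: local_space_def gain_rep_dim_component)
  also have "\<dots> = (\<Sum>X\<in>edge_components G (arcs G). gain_rep_dim \<Gamma> \<rho> G \<psi> X)"
    by (simp add: comps sum.reindex[OF inj])
  also have "(\<Sum>w\<in>verts\<^sub>0 - ?R. vec.dim (local_space w)) = card (verts\<^sub>0 - ?R) * CARD('d)"
    by (auto simp: local_space_def card_cart_basis intro!: sum.cong[THEN trans])
  finally have "vfun.dim edge_span = (\<Sum>X\<in>edge_components G (arcs G). gain_rep_dim \<Gamma> \<rho> G \<psi> X)
      + card (verts\<^sub>0 - ?R) * CARD('d)" .
  moreover have "card (edge_components G (arcs G)) = card ?R"
    by (simp add: comps card_image[OF inj])
  moreover have "card verts\<^sub>0 = card ?R + card (verts\<^sub>0 - ?R)"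
    using finite_verts0 by (subst card_Un_disjoint[symmetric]) (auto intro!: arg_cong[of _ _ card])
  ultimately show ?thesis
    by (simp only: gain_rank_def of_nat_add of_nat_mult of_nat_sum) (simp only: algebra_simps)
qed

end

theorem theorem5p3:
  fixes \<Gamma> :: "('g, 'm) monoid_scheme"
    and \<rho> :: "'g \<Rightarrow> 'f::field ^ 'd ^ 'd"
    and G :: "('v, 'e) pre_digraph"
    and \<psi> :: "'e \<Rightarrow> 'g"
  assumes "group \<Gamma>"
    and "\<rho> \<in> hom \<Gamma> GL"
    and "fin_digraph G"
    and "\<psi> \<in> arcs G \<rightarrow> carrier \<Gamma>"
  shows "gain_rank \<Gamma> \<rho> G \<psi> (arcs G)
    = int (vfun.dim (vfun.span (\<Union>e\<in>arcs G. edge_space \<rho> G \<psi> e)))"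
proof -
  interpret gain_graph \<Gamma> G \<rho> \<psi>
    using assms by (simp add: gain_graph_def gain_graph_axioms_def)
  show ?thesis
    using gain_rank_eq by (simp only: edge_span_def)
qed

end
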